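(* Let $G$ be a finite simple graph and $f\colon V(G)\to\mathbb{N}$. If $G$ is weak$^*$ $f$-degenerate, then $G$ is $f$-AT. Consequently, the Alon–Tarsi number satisfies $AT(G)\le wd^*(G)$.
   Context: $\mathbb{N}=\{0,1,2,\dots\}$. Weak$^*$ degeneracy: for pairs $(G,f)$ with $f\colon V(G)\to\mathbb{N}$, define operations (1) $\mathsf{ReduceValue}_{x,s}(G,f)=(G,f')$, $f'$ equal to $f$ except $f'(x)=f(x)-s$ ($s$ a positive integer), legal if $f(x)>s$; (2) $\mathsf{EdgeDelete}_{(x,y)}(G,f)=(G-xy,f')$ for an edge $xy$, $f'$ equal to $f$ except $f'(x)=f(x)-f(y)$, legal if $f(x)>f(y)$; (3) $\mathsf{VertexDelete}_x(G,f)=(G-x,f')$ where $f'(v)=f(v)-1$ for neighbours $v$ of $x$ and $f'(v)=f(v)$ for other $v\ne x$, legal if $f(x)>0$. $G$ is weak$^*$ $f$-degenerate if some finite sequence of legal operations transforms $(G,f)$ into the empty graph (no vertices); $wd^*(G)$ is the least integer $d$ such that $G$ is weak$^*$ $d$-degenerate. $f$-AT: fix an ordering $<$ of $V(G)$ and let $P_G=\prod_{uv\in E(G),\,u<v}(x_u-x_v)$. $G$ is $f$-AT if there is $t\colon V(G)\to\mathbb{N}$ with $t(v)+1\le f(v)$ for all $v$ such that the coefficient of $\prod_v x_v^{t(v)}$ in $P_G$ is nonzero. $AT(G)$ is the least $k$ such that $G$ is $k$-AT. *)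

theory Defs
  imports Main "HOL-Library.Poly_Mapping"
begin

type_synonym 'a graph = "'a set \<times> 'a set set"

abbreviation verts :: "'a graph \<Rightarrow> 'a set" where
  "verts G \<equiv> fst G"

abbreviation edges :: "'a graph \<Rightarrow> 'a set set" where
  "edges G \<equiv> snd G"

definition finite_simple_graph :: "'a graph \<Rightarrow> bool" where
  "finite_simple_graph G \<longleftrightarrow>
     finite (verts G) \<and> (\<forall>e \<in> edges G. e \<subseteq> verts G \<and> card e = 2)"

definition remove_edge :: "'a graph \<Rightarrow> 'a \<Rightarrow> 'a \<Rightarrow> 'a graph" where
  "remove_edge G x y = (verts G, edges G - {{x, y}})"

definition remove_vertex :: "'a graph \<Rightarrow> 'a \<Rightarrow> 'a graph" where
  "remove_vertex G x = (verts G - {x}, {e \<in> edges G. x \<notin> e})"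

text \<open>
  Functions on the vertex set are total functions on the ambient type; only their values on
  \<open>verts G\<close> matter.

  Subtraction is on the natural numbers. The legality conditions below make it exact in
  \<open>reduce_value\<close> and \<open>edge_delete\<close>. In \<open>vertex_delete\<close> it truncates only at a neighbour whose
  value is already 0; by \<open>legal_steps_value_zero\<close> such a vertex can never be deleted afterwards,
  so no truncation occurs in a sequence of legal operations that ends in the empty graph.
\<close>

fun reduce_value :: "'a \<Rightarrow> nat \<Rightarrow> 'a graph \<times> ('a \<Rightarrow> nat) \<Rightarrow> 'a graph \<times> ('a \<Rightarrow> nat)" where
  "reduce_value x s (G, f) = (G, f(x := f x - s))"

fun edge_delete :: "'a \<Rightarrow> 'a \<Rightarrow> 'a graph \<times> ('a \<Rightarrow> nat) \<Rightarrow> 'a graph \<times> ('a \<Rightarrow> nat)" where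
  "edge_delete x y (G, f) = (remove_edge G x y, f(x := f x - f y))"

fun vertex_delete :: "'a \<Rightarrow> 'a graph \<times> ('a \<Rightarrow> nat) \<Rightarrow> 'a graph \<times> ('a \<Rightarrow> nat)" where
  "vertex_delete x (G, f) =
     (remove_vertex G x, \<lambda>v. if {x, v} \<in> edges G then f v - 1 else f v)"

inductive legal_step :: "'a graph \<times> ('a \<Rightarrow> nat) \<Rightarrow> 'a graph \<times> ('a \<Rightarrow> nat) \<Rightarrow> bool" where
  legal_reduce_value:
    "x \<in> verts G \<Longrightarrow> s > 0 \<Longrightarrow> f x > s \<Longrightarrow> legal_step (G, f) (reduce_value x s (G, f))"
| legal_edge_delete:
    "{x, y} \<in> edges G \<Longrightarrow> f x > f y \<Longrightarrow> legal_step (G, f) (edge_delete x y (G, f))"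
| legal_vertex_delete:
    "x \<in> verts G \<Longrightarrow> f x > 0 \<Longrightarrow> legal_step (G, f) (vertex_delete x (G, f))"

definition weak_star_degenerate :: "'a graph \<Rightarrow> ('a \<Rightarrow> nat) \<Rightarrow> bool" where
  "weak_star_degenerate G f \<longleftrightarrow>
     (\<exists>G' f'. legal_step\<^sup>*\<^sup>* (G, f) (G', f') \<and> verts G' = {})"

definition weak_star_degeneracy :: "'a graph \<Rightarrow> nat" where
  "weak_star_degeneracy G = (LEAST d. weak_star_degenerate G (\<lambda>_. d))"

lemma legal_steps_value_zero:
  assumes "legal_step\<^sup>*\<^sup>* (G, f) (G', f')" "x \<in> verts G" "f x = 0"
  shows "x \<in> verts G' \<and> f' x = 0"
  using assms
proof (induction "(G', f')" arbitrary: G' f' rule: rtranclp_induct)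
  case base
  then show ?case by simp
next
  case (step p)
  obtain H g where p: "p = (H, g)" by (cases p)
  have "x \<in> verts H \<and> g x = 0" using step p by blast
  with step.hyps(2) show ?case
    unfolding p by cases (auto simp: remove_edge_def remove_vertex_def split: if_splits)
qed

lemma weak_star_degenerate_card:
  assumes "finite (verts G)" "\<forall>v \<in> verts G. f v \<ge> card (verts G)"
  shows "weak_star_degenerate G f"
  using assms
proof (induction "card (verts G)" arbitrary: G f)
  case 0
  then have "verts G = {}" by simp
  then show ?case unfolding weak_star_degenerate_def by blast
next
  case (Suc n)
  obtain x where x: "x \<in> verts G" using Suc.hyps(2) by fastforce
  obtain H g where Hg: "vertex_delete x (G, f) = (H, g)" by (cases "vertex_delete x (G, f)")
  have H: "verts H = verts G - {x}"
    and g: "g = (\<lambda>v. if {x, v} \<in> edges G then f v - 1 else f v)"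
    using Hg by (auto simp: remove_vertex_def)
  have "card (verts H) = n" using x Suc.hyps(2) Suc.prems(1) H by simp
  moreover have "\<forall>v \<in> verts H. g v \<ge> n"
    using Suc.prems(2) Suc.hyps(2) H g by (force dest!: bspec)
  ultimately have "weak_star_degenerate H g"
    using Suc.hyps(1)[of H g] Suc.prems(1) H by simp
  moreover have "legal_step (G, f) (H, g)"
    using legal_vertex_delete[of x G f] x Suc.prems(2) Suc.hyps(2) Hg
    by (metis Suc_le_lessD not_gr_zero not_less_zero)
  ultimately show ?case
    unfolding weak_star_degenerate_def by (meson converse_rtranclp_into_rtranclp)
qed

text \<open>
  Polynomials with integer coefficients in variables indexed by the vertices: a monomial is a
  finitely supported exponent function, a polynomial a finitely supported coefficient function
  on monomials, and \<open>Poly_Mapping.lookup\<close> extracts coefficients.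
\<close>

type_synonym 'a mpolynomial = "('a \<Rightarrow>\<^sub>0 nat) \<Rightarrow>\<^sub>0 int"

definition mvar :: "'a \<Rightarrow> 'a mpolynomial" where
  "mvar v = Poly_Mapping.single (Poly_Mapping.single v 1) 1"

text \<open>The relation \<open>r\<close> is the strict ordering of the vertices.\<close>

definition graph_polynomial :: "'a rel \<Rightarrow> 'a graph \<Rightarrow> 'a mpolynomial" where
  "graph_polynomial r G =
     (\<Prod>(u, v) \<in> {(u, v). {u, v} \<in> edges G \<and> (u, v) \<in> r}. mvar u - mvar v)"

definition alon_tarsi :: "'a rel \<Rightarrow> 'a graph \<Rightarrow> ('a \<Rightarrow> nat) \<Rightarrow> bool" where
  "alon_tarsi r G f \<longleftrightarrow>
     (\<exists>t :: 'a \<Rightarrow>\<^sub>0 nat. Poly_Mapping.keys t \<subseteq> verts G \<and>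
        (\<forall>v \<in> verts G. Poly_Mapping.lookup t v + 1 \<le> f v) \<and>
        Poly_Mapping.lookup (graph_polynomial r G) t \<noteq> 0)"

definition alon_tarsi_number :: "'a rel \<Rightarrow> 'a graph \<Rightarrow> nat" where
  "alon_tarsi_number r G = (LEAST k. alon_tarsi r G (\<lambda>_. k))"

end

theory Submission
  imports Defs
begin

text \<open>
  Each legal operation is shown to reflect the Alon--Tarsi property. For the deletion of an edge
  \<open>xy\<close> we have \<open>P\<^sub>G = \<plusminus>(x - y) Q\<close> with \<open>Q = P\<^sub>G\<^sub>-\<^sub>x\<^sub>y\<close>. If the monomial \<open>x\<^sup>a y\<^sup>b m\<close> occurs in \<open>Q\<close> but
  \<open>x\<^sup>a\<^sup>+\<^sup>1 y\<^sup>b m\<close> does not occur in \<open>P\<^sub>G\<close>, then cancellation forces \<open>x\<^sup>a\<^sup>+\<^sup>1 y\<^sup>b\<^sup>-\<^sup>1 m\<close> to occur in \<open>Q\<close>.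
  Iterating, this stops after at most \<open>b\<close> shifts, so the exponent of \<open>x\<close> grows by at most \<open>b + 1\<close>,
  which is at most \<open>f y\<close>. Deleting a vertex \<open>x\<close> amounts to reducing its value to 1,
  deleting each edge \<open>vx\<close> at the cost of 1 in \<open>f v\<close>, and discarding the isolated vertex \<open>x\<close>.
\<close>

section \<open>Coefficients of products with a variable or a difference of two variables\<close>

lemma lookup_mvar_mult:
  "Poly_Mapping.lookup (mvar u * p) k =
     (\<Sum>q. Poly_Mapping.lookup p q when k = Poly_Mapping.single u 1 + q)"
proof -
  have "Poly_Mapping.lookup (mvar u) l * c = (c when l = Poly_Mapping.single u 1)" for l c
    by (auto simp: mvar_def lookup_single when_def)
  then show ?thesis by (simp add: lookup_mult)
qed

lemma lookup_mvar_mult_add: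
  "Poly_Mapping.lookup (mvar u * p) (Poly_Mapping.single u 1 + t) = Poly_Mapping.lookup p t"
  unfolding lookup_mvar_mult by simp

lemma lookup_mvar_mult_zero:
  assumes "Poly_Mapping.lookup t u = 0"
  shows "Poly_Mapping.lookup (mvar u * p) t = 0"
proof -
  have "t \<noteq> Poly_Mapping.single u 1 + q" for q
    using assms by (auto simp: lookup_add)
  then show ?thesis unfolding lookup_mvar_mult by simp
qed

lemma exists_monomial_mvar_diff_mult:
  fixes Q :: "'a mpolynomial"
  assumes "x \<noteq> y" "Poly_Mapping.lookup Q t \<noteq> 0"
  shows "\<exists>s. Poly_Mapping.lookup ((mvar x - mvar y) * Q) s \<noteq> 0 \<and>
    Poly_Mapping.lookup s x \<le> Poly_Mapping.lookup t x + Poly_Mapping.lookup t y + 1 \<and>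
    Poly_Mapping.lookup s y \<le> Poly_Mapping.lookup t y \<and>
    (\<forall>v. v \<noteq> x \<longrightarrow> v \<noteq> y \<longrightarrow> Poly_Mapping.lookup s v = Poly_Mapping.lookup t v)"
  using assms(2)
proof (induction "Poly_Mapping.lookup t y" arbitrary: t)
  case 0
  \<comment> \<open>The variable \<open>y\<close> is absent from \<open>x * t\<close>, so no term of
    \<open>y * Q\<close> can cancel the coefficient coming from \<open>x * Q\<close>.\<close>
  have "Poly_Mapping.lookup (mvar y * Q) (Poly_Mapping.single x 1 + t) = 0"
    by (rule lookup_mvar_mult_zero) (use 0 assms(1) in \<open>simp add: lookup_add lookup_single\<close>)
  then have "Poly_Mapping.lookup ((mvar x - mvar y) * Q) (Poly_Mapping.single x 1 + t) \<noteq> 0"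
    using 0 by (simp add: left_diff_distrib lookup_minus lookup_mvar_mult_add del: One_nat_def)
  then show ?case
    using 0 assms(1)
    by (intro exI[of _ "Poly_Mapping.single x 1 + t"]) (auto simp: lookup_add lookup_single)
next
  case (Suc n)
  show ?case
  proof (cases "Poly_Mapping.lookup ((mvar x - mvar y) * Q) (Poly_Mapping.single x 1 + t) = 0")
    case False
    then show ?thesis
      using assms(1)
      by (intro exI[of _ "Poly_Mapping.single x 1 + t"]) (auto simp: lookup_add lookup_single)
  next
    case True
    \<comment> \<open>This is the monomial \<open>x * t / y\<close>; the subtraction is exact
      because \<open>y\<close> has exponent \<open>Suc n\<close> in \<open>t\<close>. The shift
      keeps the sum of the exponents of \<open>x\<close> and \<open>y\<close>, so the bound obtained
      for \<open>t'\<close> is the one wanted for \<open>t\<close>.\<close>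
    define t' where "t' = Poly_Mapping.single x 1 + (t - Poly_Mapping.single y 1)"
    have t': "Poly_Mapping.lookup t' v =
        (if v = x then Poly_Mapping.lookup t x + 1 else
         if v = y then n else Poly_Mapping.lookup t v)" for v
      using Suc.hyps(2) assms(1)
      by (auto simp: t'_def lookup_add lookup_minus lookup_single when_def)
    have "Poly_Mapping.single x 1 + t = Poly_Mapping.single y 1 + t'"
      using Suc.hyps(2) assms(1)
      by (intro poly_mapping_eqI) (auto simp: t' lookup_add lookup_single when_def)
    then have "Poly_Mapping.lookup (mvar y * Q) (Poly_Mapping.single x 1 + t) =
        Poly_Mapping.lookup Q t'"
      by (simp add: lookup_mvar_mult_add del: One_nat_def)
    with True Suc.prems have "Poly_Mapping.lookup Q t' \<noteq> 0"
      by (simp add: left_diff_distrib lookup_minus lookup_mvar_mult_add del: One_nat_def)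
    moreover have "n = Poly_Mapping.lookup t' y"
      using assms(1) by (simp add: t')
    ultimately obtain s where
      "Poly_Mapping.lookup ((mvar x - mvar y) * Q) s \<noteq> 0"
      "Poly_Mapping.lookup s x \<le> Poly_Mapping.lookup t' x + Poly_Mapping.lookup t' y + 1"
      "Poly_Mapping.lookup s y \<le> Poly_Mapping.lookup t' y"
      "\<forall>v. v \<noteq> x \<longrightarrow> v \<noteq> y \<longrightarrow> Poly_Mapping.lookup s v = Poly_Mapping.lookup t' v"
      using Suc.hyps(1)[of t'] by blast
    then show ?thesis
      using Suc.hyps(2) assms(1) by (intro exI[of _ s]) (auto simp: t')
  qed
qed

section \<open>Factoring an edge out of the graph polynomial\<close>

lemma graph_polynomial_remove_edge:
  assumes G: "finite_simple_graph G" and r: "strict_linear_order_on (verts G) r"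
    and e: "{x, y} \<in> edges G"
  shows "graph_polynomial r G = (mvar x - mvar y) * graph_polynomial r (remove_edge G x y) \<or>
    graph_polynomial r G = - ((mvar x - mvar y) * graph_polynomial r (remove_edge G x y))"
proof -
  let ?A = "\<lambda>E. {(u, v). {u, v} \<in> E \<and> (u, v) \<in> r}"
  \<comment> \<open>Asymmetry makes each edge contribute a single factor; which way \<open>r\<close>
    orients the edge decides the sign.\<close>
  have asym: "(u, v) \<in> r \<Longrightarrow> (v, u) \<notin> r" for u v
    using r by (auto simp: strict_linear_order_on_def irrefl_def dest: transD)
  have oriented: "graph_polynomial r G =
      (mvar a - mvar b) * graph_polynomial r (remove_edge G x y)"
    if ab: "(a, b) \<in> r" "{a, b} = {x, y}" for a b
  proof -
    have "?A (edges G) \<subseteq> verts G \<times> verts G"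
      using G by (auto simp: finite_simple_graph_def)
    then have fin: "finite (?A (edges G))"
      using G by (meson finite_SigmaI finite_subset finite_simple_graph_def)
    have "?A (edges G) = insert (a, b) (?A (edges G - {{x, y}}))"
      using ab e asym by (auto simp: doubleton_eq_iff insert_commute)
    moreover have "(a, b) \<notin> ?A (edges G - {{x, y}})"
      using ab by simp
    moreover have "finite (?A (edges G - {{x, y}}))"
      by (rule finite_subset[OF _ fin]) auto
    ultimately show ?thesis
      by (simp add: graph_polynomial_def remove_edge_def)
  qed
  have "x \<noteq> y" "x \<in> verts G" "y \<in> verts G"
    using G e by (auto simp: finite_simple_graph_def)
  then have "(x, y) \<in> r \<or> (y, x) \<in> r"
    using r by (auto simp: strict_linear_order_on_def total_on_def)
  then show ?thesis
  proof
    assume "(x, y) \<in> r"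
    then show ?thesis using oriented by blast
  next
    assume "(y, x) \<in> r"
    then have "graph_polynomial r G = (mvar y - mvar x) * graph_polynomial r (remove_edge G x y)"
      using oriented by blast
    then show ?thesis by (simp add: algebra_simps)
  qed
qed

section \<open>Undoing the deletion of edges and vertices\<close>

lemma alon_tarsi_mono:
  assumes "alon_tarsi r G f" "\<And>v. v \<in> verts G \<Longrightarrow> f v \<le> g v"
  shows "alon_tarsi r G g"
  using assms unfolding alon_tarsi_def by (meson order_trans)

text \<open>Exponents are nonnegative, so each bound is at least 1. This recovers strict
  inequalities hidden by truncated subtraction.\<close>

lemma alon_tarsi_pos:
  assumes "alon_tarsi r G f" "v \<in> verts G"
  shows "0 < f v"
  using assms unfolding alon_tarsi_def by fastforce

lemma alon_tarsi_edge_delete: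
  assumes G: "finite_simple_graph G" and r: "strict_linear_order_on (verts G) r"
    and e: "{x, y} \<in> edges G" and f: "f y < f x"
    and at: "alon_tarsi r (remove_edge G x y) (f(x := f x - f y))"
  shows "alon_tarsi r G f"
proof -
  have xy: "x \<noteq> y" "x \<in> verts G" "y \<in> verts G"
    using G e by (auto simp: finite_simple_graph_def)
  obtain t where t: "Poly_Mapping.keys t \<subseteq> verts G"
    "\<And>v. v \<in> verts G \<Longrightarrow> Poly_Mapping.lookup t v + 1 \<le> (f(x := f x - f y)) v"
    "Poly_Mapping.lookup (graph_polynomial r (remove_edge G x y)) t \<noteq> 0"
    using at unfolding alon_tarsi_def by (auto simp: remove_edge_def)
  obtain s where
    s: "Poly_Mapping.lookup ((mvar x - mvar y) * graph_polynomial r (remove_edge G x y)) s \<noteq> 0"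
    "Poly_Mapping.lookup s x \<le> Poly_Mapping.lookup t x + Poly_Mapping.lookup t y + 1"
    "Poly_Mapping.lookup s y \<le> Poly_Mapping.lookup t y"
    "\<forall>v. v \<noteq> x \<longrightarrow> v \<noteq> y \<longrightarrow> Poly_Mapping.lookup s v = Poly_Mapping.lookup t v"
    using exists_monomial_mvar_diff_mult[OF xy(1) t(3)] by blast
  have "Poly_Mapping.lookup (graph_polynomial r G) s \<noteq> 0"
    using graph_polynomial_remove_edge[OF G r e] s(1) by auto
  moreover have "Poly_Mapping.keys s \<subseteq> verts G"
    using s(4) t(1) xy by (metis in_keys_iff subset_iff)
  \<comment> \<open>At \<open>x\<close>, the two bounds on \<open>t\<close> add up: \<open>s x + 1
    \<le> (t x + 1) + (t y + 1) \<le> (f x - f y) + f y = f x\<close>, writing exponents as function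
    values.\<close>
  moreover have "Poly_Mapping.lookup s v + 1 \<le> f v" if "v \<in> verts G" for v
    using s(2-4) t(2)[OF xy(2)] t(2)[OF xy(3)] t(2)[OF that] xy(1) f
    by (cases "v = x"; cases "v = y") auto
  ultimately show ?thesis unfolding alon_tarsi_def by blast
qed

text \<open>Since \<open>f x = 1\<close>, putting back an edge from \<open>v\<close> to
  \<open>x\<close> raises the value at \<open>v\<close> by exactly 1, and the value at
  \<open>x\<close> never changes. The edges are restored one at a time.\<close>

lemma alon_tarsi_star_delete:
  assumes G: "finite_simple_graph G" and r: "strict_linear_order_on (verts G) r"
    and "finite S" "\<forall>v\<in>S. {x, v} \<in> edges G" "f x = 1"
    and "alon_tarsi r (verts G, edges G - (\<lambda>v. {x, v}) ` S) (\<lambda>v. if v \<in> S then f v - 1 else f v)"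
  shows "alon_tarsi r G f"
  using assms(3-)
proof (induction S)
  case empty
  then show ?case by simp
next
  case (insert w S)
  let ?H = "(verts G, edges G - (\<lambda>v. {x, v}) ` S)"
  let ?g = "\<lambda>v. if v \<in> S then f v - 1 else f v"
  have nx: "v \<noteq> x" "v \<in> verts G" if "v \<in> insert w S" for v
  proof -
    have "{x, v} \<in> edges G" using insert.prems(1) that by blast
    then show "v \<noteq> x" "v \<in> verts G" using G by (auto simp: finite_simple_graph_def)
  qed
  have "edges G - (\<lambda>v. {x, v}) ` insert w S = edges ?H - {{w, x}}"
    by (auto simp: insert_commute)
  moreover have "(\<lambda>v. if v \<in> insert w S then f v - 1 else f v) = ?g(w := ?g w - ?g x)"
    using insert.hyps(2) insert.prems(2) nx by (auto simp: fun_eq_iff)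
  ultimately have "alon_tarsi r (remove_edge ?H w x) (?g(w := ?g w - ?g x))"
    using insert.prems(3) by (simp add: remove_edge_def)
  \<comment> \<open>Positivity of the reduced value \<open>f w - 1\<close> gives
    \<open>f w > 1 = f x\<close>, the legality condition for this edge.\<close>
  moreover have "?g x < ?g w"
    using alon_tarsi_pos[OF insert.prems(3), of w] nx insert.hyps(2) insert.prems(2) by auto
  moreover have "{w, x} \<in> edges ?H"
    using insert.hyps(2) insert.prems(1) nx by (auto simp: insert_commute doubleton_eq_iff)
  moreover have "finite_simple_graph ?H"
    using G by (auto simp: finite_simple_graph_def)
  ultimately have "alon_tarsi r ?H ?g"
    using alon_tarsi_edge_delete[of ?H r w x ?g] r by simp
  then show ?case using insert by simp
qed

lemma alon_tarsi_vertex_delete: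
  assumes G: "finite_simple_graph G" and r: "strict_linear_order_on (verts G) r"
    and x: "x \<in> verts G" "0 < f x"
    and at: "alon_tarsi r (remove_vertex G x) (\<lambda>v. if {x, v} \<in> edges G then f v - 1 else f v)"
  shows "alon_tarsi r G f"
proof -
  define S where "S = {v. {x, v} \<in> edges G}"
  have "S \<subseteq> verts G" and xS: "x \<notin> S"
    using G by (auto simp: S_def finite_simple_graph_def)
  then have S: "finite S" using G finite_subset by (auto simp: finite_simple_graph_def)
  have E: "{e \<in> edges G. x \<notin> e} = edges G - (\<lambda>v. {x, v}) ` S"
  proof -
    have "e \<in> (\<lambda>v. {x, v}) ` S" if e: "e \<in> edges G" "x \<in> e" for e
    proof -
      have "card e = 2" using G e by (auto simp: finite_simple_graph_def)
      then obtain v where "e = {x, v}"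
        using e(2) by (auto simp: card_2_iff insert_commute)
      then show ?thesis using e(1) by (auto simp: S_def)
    qed
    then show ?thesis by auto
  qed
  obtain t where t: "Poly_Mapping.keys t \<subseteq> verts G - {x}"
    "\<forall>v \<in> verts G - {x}. Poly_Mapping.lookup t v + 1 \<le> (if v \<in> S then f v - 1 else f v)"
    "Poly_Mapping.lookup (graph_polynomial r (remove_vertex G x)) t \<noteq> 0"
    using at unfolding alon_tarsi_def S_def by (auto simp: remove_vertex_def)
  \<comment> \<open>Exponent 0 at \<open>x\<close> meets the bound for the value 1, so
    \<open>t\<close> also serves for the graph that keeps \<open>x\<close> as an isolated
    vertex.\<close>
  have "Poly_Mapping.lookup t x = 0"
    using t(1) by (auto simp: in_keys_iff)
  then have "Poly_Mapping.lookup t v + 1 \<le> (if v \<in> S then (f(x := 1)) v - 1 else (f(x := 1)) v)"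
    if "v \<in> verts G" for v
    using t(2)[rule_format, of v] that xS by (cases "v = x") auto
  moreover have "graph_polynomial r (verts G, edges G - (\<lambda>v. {x, v}) ` S) =
      graph_polynomial r (remove_vertex G x)"
    by (simp add: graph_polynomial_def remove_vertex_def flip: E)
  ultimately have "alon_tarsi r (verts G, edges G - (\<lambda>v. {x, v}) ` S)
      (\<lambda>v. if v \<in> S then (f(x := 1)) v - 1 else (f(x := 1)) v)"
    unfolding alon_tarsi_def using t(1,3) by (intro exI[of _ t]) auto
  then have "alon_tarsi r G (f(x := 1))"
    using alon_tarsi_star_delete[OF G r S, of x "f(x := 1)"] by (simp add: S_def)
  then show ?thesis
    by (rule alon_tarsi_mono) (use x in auto)
qed

section \<open>Sequences of legal operations\<close>

lemma legal_step_alon_tarsi: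
  assumes "legal_step (G, f) (G', f')" "finite_simple_graph G"
    "strict_linear_order_on (verts G) r" "alon_tarsi r G' f'"
  shows "alon_tarsi r G f"
  using assms(1)
proof cases
  case (legal_reduce_value x s)
  then show ?thesis using assms(4) by (auto intro: alon_tarsi_mono)
next
  case (legal_edge_delete x y)
  then show ?thesis using assms alon_tarsi_edge_delete[of G r x y f] by auto
next
  case (legal_vertex_delete x)
  then show ?thesis using assms alon_tarsi_vertex_delete[of G r x f] by auto
qed

lemma legal_step_graph:
  assumes "legal_step (G, f) (G', f')" "finite_simple_graph G"
  shows "finite_simple_graph G'" "verts G' \<subseteq> verts G"
  using assms
  by (cases; auto simp: finite_simple_graph_def remove_edge_def remove_vertex_def)+

text \<open>The polynomial is an empty product, and the constant monomial has coefficient 1 in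
  it.\<close>

lemma alon_tarsi_empty:
  assumes "finite_simple_graph G" "verts G = {}"
  shows "alon_tarsi r G f"
proof -
  have "edges G = {}" using assms by (fastforce simp: finite_simple_graph_def)
  then show ?thesis
    using assms(2) by (auto simp: alon_tarsi_def graph_polynomial_def intro!: exI[of _ 0])
qed

lemma weak_star_degenerate_imp_alon_tarsi:
  assumes "weak_star_degenerate G f" "finite_simple_graph G"
    "strict_linear_order_on (verts G) r"
  shows "alon_tarsi r G f"
proof -
  obtain G' f' where steps: "legal_step\<^sup>*\<^sup>* (G, f) (G', f')" and "verts G' = {}"
    using assms(1) by (auto simp: weak_star_degenerate_def)
  from steps assms(2,3) show ?thesis
  \<comment> \<open>The property is pulled back from the empty graph, one operation at a
    time.\<close>
  proof (induction "(G, f)" arbitrary: G f rule: converse_rtranclp_induct)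
    case base
    then show ?case using \<open>verts G' = {}\<close> alon_tarsi_empty by blast
  next
    case (step p)
    obtain H g where p: "p = (H, g)" by (cases p)
    note H = legal_step_graph[OF step.hyps(1)[unfolded p] step.prems(1)]
    \<comment> \<open>Only totality refers to the vertex set, and it passes to subsets, so one
      ordering serves every graph in the sequence.\<close>
    have "strict_linear_order_on (verts H) r"
      using step.prems(2) H(2) by (auto simp: strict_linear_order_on_def intro: total_on_subset)
    then have "alon_tarsi r H g" using step.hyps(3)[OF p] H(1) by blast
    then show ?case using legal_step_alon_tarsi step p by blast
  qed
qed

theorem theorem2:
  fixes G :: "'a graph" and f :: "'a \<Rightarrow> nat" and r :: "'a rel"
  assumes "finite_simple_graph G"
    and "strict_linear_order_on (verts G) r"
  shows "(weak_star_degenerate G f \<longrightarrow> alon_tarsi r G f) \<and>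
         alon_tarsi_number r G \<le> weak_star_degeneracy G"
proof
  show "weak_star_degenerate G f \<longrightarrow> alon_tarsi r G f"
    using weak_star_degenerate_imp_alon_tarsi assms by blast
  \<comment> \<open>Some constant value works, so the \<open>LEAST\<close> in
    \<open>weak_star_degeneracy\<close> is attained.\<close>
  have "weak_star_degenerate G (\<lambda>_. card (verts G))"
    using assms(1) by (intro weak_star_degenerate_card) (auto simp: finite_simple_graph_def)
  then have "weak_star_degenerate G (\<lambda>_. weak_star_degeneracy G)"
    unfolding weak_star_degeneracy_def by (rule LeastI)
  then have "alon_tarsi r G (\<lambda>_. weak_star_degeneracy G)"
    using weak_star_degenerate_imp_alon_tarsi assms by blast
  then show "alon_tarsi_number r G \<le> weak_star_degeneracy G"
    unfolding alon_tarsi_number_def by (rule Least_le)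
qed

end
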